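(* For $\sigma\ge0$ and $\bar H\ge0$, not both zero, let $n_*=n_*(\sigma,\bar H)>0$ be the optimal constellation size, i.e. the positive solution of $2\sigma n_*^{1.5}+4n_*\bar H=1$. Then: Scenario I: as the contention overhead $\sigma\to0$ with $\bar H>0$ fixed, $n_*\to\dfrac{1}{4\bar H}$. Scenario II: as the consensus overhead $\bar H\to0$ with $\sigma>0$ fixed, $n_*\to\left(\dfrac{1}{2\sigma}\right)^{2/3}$.
   Context: $\sigma$ is the contention overhead per single-hop transmission. $\bar H$ stands for $\bar H_k(\alpha,\beta)$, the lower bound on the consensus overhead per inter-satellite link, treated here as a nonnegative real parameter: $\bar H_k(\alpha,\beta)=\frac1k\left[h(\pi_1)+(k-1)\left(\pi_1h(\alpha)+\pi_0h(\beta)\right)\right]$, with $h(x)=-x\log_2x-(1-x)\log_2(1-x)$, $\pi_1=\frac{\beta}{\alpha+\beta}$, $\pi_0=\frac{\alpha}{\alpha+\beta}$, $\alpha$ the failure probability, $\beta$ the recovery probability, and $k\ge1$ the maintenance period. The optimal size is the one maximizing $\frac{16\sqrt n}{1+\sigma n^{1.5}+4n\bar H}$ over $n>0$. *)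

theory Defs
  imports Complex_Main
begin

text \<open>The size \<open>n\<close> is a positive real; \<open>H\<close> is the lower bound on the consensus
  overhead per link, taken as a nonnegative real parameter.\<close>

definition objective :: "real \<Rightarrow> real \<Rightarrow> real \<Rightarrow> real" where
  "objective \<sigma> H n = 16 * sqrt n / (1 + \<sigma> * n powr (3/2) + 4 * n * H)"

text \<open>The library's \<open>arg_max\<close> picks an arbitrary maximizer (and is unspecified if there is
  none), so existence and uniqueness have to be stated separately.\<close>

definition optimal_size :: "real \<Rightarrow> real \<Rightarrow> real" where
  "optimal_size \<sigma> H = arg_max (objective \<sigma> H) (\<lambda>n. n > 0)"

end

theory Submission
  imports Defs
begin

text \<open>With \<open>s = sqrt n\<close>, maximizing the objective means minimizing
  \<open>1/s + \<sigma> s\<^sup>2 + 4 H s\<close>.  If \<open>t\<close> solves \<open>2 \<sigma> t\<^sup>3 + 4 H t\<^sup>2 = 1\<close>, then \<open>s\<close> times the excess of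
  the value at \<open>s\<close> over the value at \<open>t\<close> is the square \<open>(s - t)\<^sup>2\<close> times
  \<open>\<sigma> (s + 2 t) + 4 H > 0\<close>; so \<open>t\<close> is the unique minimizer, and no calculus is needed.
  For the limits, the equation itself bounds \<open>n\<close> from above independently of the vanishing
  parameter, so the term carrying that parameter vanishes.\<close>

lemma powr_three_halves_eq: "n > 0 \<Longrightarrow> n powr (3/2) = sqrt n ^ 3" for n :: real
  using powr_powr[of n "1/2" 3] by (simp add: powr_half_sqrt)

lemma objective_less:
  fixes \<sigma> H n m :: real
  assumes nonneg: "\<sigma> \<ge> 0" "H \<ge> 0" and "n > 0"
    and root: "2 * \<sigma> * n powr (3/2) + 4 * n * H = 1" and "m > 0" "m \<noteq> n"
  shows "objective \<sigma> H m < objective \<sigma> H n"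
proof -
  define s t where "s = sqrt m" and "t = sqrt n"
  have pos: "s > 0" "t > 0" and ne: "s \<noteq> t"
    using assms by (auto simp: s_def t_def)
  have sq: "m = s^2" "n = t^2" using assms by (auto simp: s_def t_def)
  have pw: "m powr (3/2) = s^3" "n powr (3/2) = t^3"
    using assms by (auto simp: s_def t_def powr_three_halves_eq)
  have root': "2 * \<sigma> * t^3 + 4 * t^2 * H = 1" using root pw sq by simp
  \<comment> \<open>If both parameters were zero, \<open>root'\<close> would read 0 = 1. One
    positive parameter is what makes the second factor of the product below strictly
    positive.\<close>
  have "\<sigma> > 0 \<or> H > 0" using root' nonneg by (cases "\<sigma> = 0"; cases "H = 0") auto
  then have "(s - t)^2 * (\<sigma> * (s + 2 * t) + 4 * H) > 0"
    using pos ne nonneg by (intro mult_pos_pos) (auto intro: add_pos_nonneg add_nonneg_pos)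
  then have "t * ((s - t)^2 * (\<sigma> * (s + 2 * t) + 4 * H)) > 0" using pos by simp
  \<comment> \<open>The last summand is zero by \<open>root'\<close>; adding it turns the
    factorization into a polynomial identity.\<close>
  also have "t * ((s - t)^2 * (\<sigma> * (s + 2 * t) + 4 * H)) =
      t * (1 + \<sigma> * s^3 + 4 * s^2 * H) - s * (1 + \<sigma> * t^3 + 4 * t^2 * H)
      + (s - t) * (1 - (2 * \<sigma> * t^3 + 4 * t^2 * H))"
    by (simp add: algebra_simps power2_eq_square power3_eq_cube)
  finally have *: "s * (1 + \<sigma> * t^3 + 4 * t^2 * H) < t * (1 + \<sigma> * s^3 + 4 * s^2 * H)"
    using root' by simp
  have "1 + \<sigma> * t^3 + 4 * t^2 * H > 0" "1 + \<sigma> * s^3 + 4 * s^2 * H > 0"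
    using nonneg pos by (auto intro!: add_pos_nonneg)
  with * have "s / (1 + \<sigma> * s^3 + 4 * s^2 * H) < t / (1 + \<sigma> * t^3 + 4 * t^2 * H)"
    by (simp only: pos_divide_less_eq pos_less_divide_eq times_divide_eq_left)
  then show ?thesis
    unfolding objective_def pw s_def[symmetric] t_def[symmetric] sq[symmetric] by simp
qed

text \<open>Intermediate value theorem on \<open>{0..b}\<close>: the left-hand side is 0 at 0 and at
  least 1 at \<open>b\<close>.\<close>

lemma ex_stationary:
  fixes \<sigma> H :: real
  assumes nonneg: "\<sigma> \<ge> 0" "H \<ge> 0" and nz: "\<not> (\<sigma> = 0 \<and> H = 0)"
  shows "\<exists>n>0. 2 * \<sigma> * n powr (3/2) + 4 * n * H = 1"
proof -
  define c where "c = \<sigma> + H"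
  \<comment> \<open>From \<open>b \<ge> 1\<close> follows \<open>b powr (3/2) \<ge> b\<close>, so
    the left-hand side at \<open>b\<close> is at least \<open>c * b\<close>, and
    \<open>b \<ge> 1/c\<close> makes this at least 1.\<close>
  define b where "b = max 1 (1/c)"
  have c: "c > 0" using assms by (auto simp: c_def)
  have "c * (1/c) \<le> c * b" using c by (intro mult_left_mono) (auto simp: b_def)
  then have b: "b \<ge> 1" "c * b \<ge> 1" using c by (auto simp: b_def)
  have "b \<le> b powr (3/2)" using powr_mono[of 1 "3/2" b] b by simp
  then have "\<sigma> * b \<le> \<sigma> * b powr (3/2)" using nonneg(1) by (rule mult_left_mono)
  moreover have "H * b \<ge> 0" "\<sigma> * b \<ge> 0" using nonneg b by auto
  ultimately have upper: "2 * \<sigma> * b powr (3/2) + 4 * b * H \<ge> 1"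
    using b by (simp add: c_def algebra_simps)
  have "\<exists>n\<ge>0. n \<le> b \<and> 2 * \<sigma> * n powr (3/2) + 4 * n * H = 1"
  proof (rule IVT'[where f = "\<lambda>n. 2 * \<sigma> * n powr (3/2) + 4 * n * H", simplified])
    show "continuous_on {0..b} (\<lambda>n. 2 * \<sigma> * n powr (3/2) + 4 * n * H)"
      by (intro continuous_intros continuous_on_powr') auto
  qed (use b upper in auto)
  then obtain n where n: "n \<ge> 0" "2 * \<sigma> * n powr (3/2) + 4 * n * H = 1" by blast
  \<comment> \<open>At 0 the equation would read 0 = 1.\<close>
  moreover from this have "n \<noteq> 0" by auto
  ultimately show ?thesis by (auto simp: order_less_le)
qed

lemma is_arg_max_objective_iff:
  fixes \<sigma> H n m :: real
  assumes "\<sigma> \<ge> 0" "H \<ge> 0" "n > 0" "2 * \<sigma> * n powr (3/2) + 4 * n * H = 1"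
  shows "is_arg_max (objective \<sigma> H) (\<lambda>n. n > 0) m \<longleftrightarrow> m = n"
  using objective_less[OF assms] assms(3) unfolding is_arg_max_def
  by (metis less_asym)

text \<open>The choice made by \<open>arg_max\<close> is forced, because a root of the stationarity
  equation is the only maximizer.\<close>

lemma optimal_size_eqI:
  fixes \<sigma> H n :: real
  assumes "\<sigma> \<ge> 0" "H \<ge> 0" "n > 0" "2 * \<sigma> * n powr (3/2) + 4 * n * H = 1"
  shows "optimal_size \<sigma> H = n"
  unfolding optimal_size_def arg_max_def is_arg_max_objective_iff[OF assms] by simp

lemma optimal_size_stationary:
  fixes \<sigma> H :: real
  assumes "\<sigma> \<ge> 0" "H \<ge> 0" "\<not> (\<sigma> = 0 \<and> H = 0)"
  shows "optimal_size \<sigma> H > 0"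
    and "2 * \<sigma> * optimal_size \<sigma> H powr (3/2) + 4 * optimal_size \<sigma> H * H = 1"
proof -
  obtain n where "n > 0" "2 * \<sigma> * n powr (3/2) + 4 * n * H = 1"
    using ex_stationary[OF assms] by blast
  moreover from this have "optimal_size \<sigma> H = n" by (rule optimal_size_eqI[OF assms(1,2)])
  ultimately show "optimal_size \<sigma> H > 0"
    and "2 * \<sigma> * optimal_size \<sigma> H powr (3/2) + 4 * optimal_size \<sigma> H * H = 1"
    by simp_all
qed

text \<open>Dropping the nonnegative \<open>\<sigma>\<close> term from the equation bounds the size
  above by the limit \<open>?N\<close>; inserting \<open>?N\<close> into that term gives a lower
  bound that is affine in \<open>\<sigma>\<close> and tends to \<open>?N\<close>.\<close>

lemma optimal_size_tendsto_no_contention: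
  fixes H :: real
  assumes H: "H > 0"
  shows "((\<lambda>\<sigma>. optimal_size \<sigma> H) \<longlongrightarrow> 1 / (4 * H)) (at_right 0)"
proof (rule tendsto_sandwich)
  let ?N = "1 / (4 * H)"
  have bounds: "optimal_size \<sigma> H \<le> ?N \<and> (1 - 2 * \<sigma> * ?N powr (3/2)) / (4 * H) \<le> optimal_size \<sigma> H"
    if "\<sigma> > 0" for \<sigma>
  proof -
    let ?n = "optimal_size \<sigma> H"
    have n: "?n > 0" "2 * \<sigma> * ?n powr (3/2) + 4 * ?n * H = 1"
      using optimal_size_stationary[of \<sigma> H] that H by auto
    have "2 * \<sigma> * ?n powr (3/2) \<ge> 0" using that by simp
    then have upper: "?n \<le> ?N" using n H by (simp add: field_simps)
    then have "?n powr (3/2) \<le> ?N powr (3/2)" using n by (intro powr_mono2) auto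
    then have "2 * \<sigma> * ?n powr (3/2) \<le> 2 * \<sigma> * ?N powr (3/2)" using that by simp
    then have "1 - 2 * \<sigma> * ?N powr (3/2) \<le> ?n * (4 * H)" using n by simp
    then show ?thesis using upper H by (simp add: pos_divide_le_eq)
  qed
  show "\<forall>\<^sub>F \<sigma> in at_right 0. (1 - 2 * \<sigma> * ?N powr (3/2)) / (4 * H) \<le> optimal_size \<sigma> H"
    and "\<forall>\<^sub>F \<sigma> in at_right 0. optimal_size \<sigma> H \<le> ?N"
    using bounds by (auto intro: eventually_at_right_less[THEN eventually_mono])
  show "((\<lambda>\<sigma>. (1 - 2 * \<sigma> * ?N powr (3/2)) / (4 * H)) \<longlongrightarrow> ?N) (at_right 0)"
    using H by (auto intro!: tendsto_eq_intros)
qed simp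

text \<open>The sandwich is applied to the power 3/2 of the size, in which the surviving term is
  linear; the power 2/3 then recovers the size.\<close>

lemma optimal_size_tendsto_no_consensus:
  fixes \<sigma> :: real
  assumes \<sigma>: "\<sigma> > 0"
  shows "((\<lambda>H. optimal_size \<sigma> H) \<longlongrightarrow> (1 / (2 * \<sigma>)) powr (2/3)) (at_right 0)"
proof -
  let ?N = "(1 / (2 * \<sigma>)) powr (2/3)"
  have bounds: "optimal_size \<sigma> H > 0 \<and> optimal_size \<sigma> H powr (3/2) \<le> 1 / (2 * \<sigma>) \<and>
      (1 - 4 * ?N * H) / (2 * \<sigma>) \<le> optimal_size \<sigma> H powr (3/2)"
    if "H > 0" for H
  proof -
    let ?n = "optimal_size \<sigma> H"
    have n: "?n > 0" "2 * \<sigma> * ?n powr (3/2) + 4 * ?n * H = 1"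
      using optimal_size_stationary[of \<sigma> H] that \<sigma> by auto
    have "?n * H > 0" using n that by simp
    then have upper: "?n powr (3/2) \<le> 1 / (2 * \<sigma>)" using n \<sigma> by (simp add: field_simps)
    \<comment> \<open>The vanishing term contains the size itself, so the bound on its power is
      first turned into a bound by \<open>?N\<close>.\<close>
    then have "(?n powr (3/2)) powr (2/3) \<le> ?N" by (intro powr_mono2) auto
    then have "?n \<le> ?N" using n by (simp add: powr_powr)
    then have "4 * ?n * H \<le> 4 * ?N * H" using that by simp
    then have "1 - 4 * ?N * H \<le> ?n powr (3/2) * (2 * \<sigma>)" using n by (simp add: algebra_simps)
    then show ?thesis using n upper \<sigma> by (simp add: pos_divide_le_eq)
  qed
  have "((\<lambda>H. optimal_size \<sigma> H powr (3/2)) \<longlongrightarrow> 1 / (2 * \<sigma>)) (at_right 0)"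
  proof (rule tendsto_sandwich)
    show "\<forall>\<^sub>F H in at_right 0. (1 - 4 * ?N * H) / (2 * \<sigma>) \<le> optimal_size \<sigma> H powr (3/2)"
      and "\<forall>\<^sub>F H in at_right 0. optimal_size \<sigma> H powr (3/2) \<le> 1 / (2 * \<sigma>)"
      using bounds by (auto intro: eventually_at_right_less[THEN eventually_mono])
    show "((\<lambda>H. (1 - 4 * ?N * H) / (2 * \<sigma>)) \<longlongrightarrow> 1 / (2 * \<sigma>)) (at_right 0)"
      using \<sigma> by (auto intro!: tendsto_eq_intros)
  qed simp
  \<comment> \<open>Continuity of \<open>powr\<close> applies because the limit of the base,
    \<open>1 / (2 * \<sigma>)\<close>, is nonzero.\<close>
  then have "((\<lambda>H. (optimal_size \<sigma> H powr (3/2)) powr (2/3)) \<longlongrightarrow> ?N) (at_right 0)"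
    using \<sigma> by (intro tendsto_powr) auto
  moreover have "\<forall>\<^sub>F H in at_right 0. (optimal_size \<sigma> H powr (3/2)) powr (2/3) = optimal_size \<sigma> H"
    by (rule eventually_at_right_less[THEN eventually_mono]) (use bounds in \<open>fastforce simp: powr_powr\<close>)
  ultimately show ?thesis by (rule Lim_transform_eventually)
qed

text \<open>The two equivalences give existence and uniqueness, both of the maximizer and of the
  positive root, and so identify them. The limits are one-sided because the overheads are
  nonnegative.\<close>

theorem corollary3:
  shows "(\<forall>\<sigma> H :: real. \<sigma> \<ge> 0 \<longrightarrow> H \<ge> 0 \<longrightarrow> \<not> (\<sigma> = 0 \<and> H = 0) \<longrightarrow>
            (\<forall>n. is_arg_max (objective \<sigma> H) (\<lambda>n. n > 0) n \<longleftrightarrow> n = optimal_size \<sigma> H) \<and>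
            (\<forall>n. n > 0 \<and> 2 * \<sigma> * n powr (3/2) + 4 * n * H = 1 \<longleftrightarrow> n = optimal_size \<sigma> H))
       \<and> (\<forall>H :: real. H > 0 \<longrightarrow>
            ((\<lambda>\<sigma>. optimal_size \<sigma> H) \<longlongrightarrow> 1 / (4 * H)) (at_right 0))
       \<and> (\<forall>\<sigma> :: real. \<sigma> > 0 \<longrightarrow>
            ((\<lambda>H. optimal_size \<sigma> H) \<longlongrightarrow> (1 / (2 * \<sigma>)) powr (2/3)) (at_right 0))"
proof (intro conjI allI impI)
  fix \<sigma> H n :: real
  assume *: "\<sigma> \<ge> 0" "H \<ge> 0" "\<not> (\<sigma> = 0 \<and> H = 0)"
  show "is_arg_max (objective \<sigma> H) (\<lambda>n. n > 0) n \<longleftrightarrow> n = optimal_size \<sigma> H"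
    by (rule is_arg_max_objective_iff[OF *(1,2) optimal_size_stationary[OF *]])
  show "n > 0 \<and> 2 * \<sigma> * n powr (3/2) + 4 * n * H = 1 \<longleftrightarrow> n = optimal_size \<sigma> H"
    using optimal_size_eqI[OF *(1,2), of n] optimal_size_stationary[OF *] by blast
qed (rule optimal_size_tendsto_no_contention optimal_size_tendsto_no_consensus; assumption)+

end
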